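(* Suppose that $h_2(n) < p_n^2 - p_n$ holds for all integers $n \ge 3$. Then both of the following hold: (1) (Goldbach conjecture) for every integer $n > 1$ there exist primes $q_1, q_2$ with $q_1 + q_2 = 2n$; (2) (infinitude of prime pairs for every even difference) for every integer $n \ge 1$ there exist infinitely many pairs $(q_1, q_2)$ of primes with $q_2 - q_1 = 2n$.
   Context: $\mathbb{N}$ denotes the positive integers. $p_i$ denotes the $i$-th prime, with $p_1 = 2$, and $p_n\# = \prod_{i=1}^n p_i$. Two primes $q_1, q_2$ are not required to be distinct. An integer $k$ and a pair $(a,b) \in \mathbb{Z}^2$ are called coprime if $\gcd(k,a) = 1$ and $\gcd(k,b) = 1$. For $n \in \mathbb{N}$, the paired Jacobsthal function $j_2(n)$ is the smallest $m \in \mathbb{N}$ such that for all $(a,b) \in \mathbb{Z}^2$ with $2 \mid (b-a)$ there exists $q \in \{1,\dots,m\}$ such that $n$ is coprime to the pair $(a+q, b+q)$. The primorial paired Jacobsthal function is $h_2(n) = j_2(p_n\#)$ for $n \in \mathbb{N}$. *)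

theory Defs
  imports "HOL-Number_Theory.Number_Theory" "HOL-Library.Infinite_Set"
begin

(* The i-th prime in the 1-based numbering, nth_prime 1 = 2.  The library enumeration
   starts at 0; the argument 0 is never used. *)
definition nth_prime :: "nat \<Rightarrow> nat" where
  "nth_prime i = enumerate {p. prime p} (i - 1)"

definition primorial :: "nat \<Rightarrow> nat" where
  "primorial n = (\<Prod>i=1..n. nth_prime i)"

definition coprime_pair :: "int \<Rightarrow> int \<times> int \<Rightarrow> bool" where
  "coprime_pair k ab \<longleftrightarrow> gcd k (fst ab) = 1 \<and> gcd k (snd ab) = 1"

(* For n \<ge> 1 such an m always exists: the condition 2 dvd b - a excludes only one residue class
   modulo 2, and at most two classes are excluded modulo any odd prime factor of n. *)
definition j2 :: "nat \<Rightarrow> nat" where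
  "j2 n = (LEAST m. m \<ge> 1 \<and>
     (\<forall>a b :: int. 2 dvd (b - a) \<longrightarrow>
        (\<exists>q\<in>{1..m}. coprime_pair (int n) (a + int q, b + int q))))"

definition h2 :: "nat \<Rightarrow> nat" where
  "h2 n = j2 (primorial n)"

end

theory Submission
  imports Defs
begin

text \<open>
  Both statements come from one sieve.  For a prime \<open>P = p\<^sub>n \<ge> 5\<close> and an even \<open>d\<close>, the bound on
  \<open>h\<^sub>2(n)\<close>, applied to the pair \<open>(1, 1 + d)\<close>, yields some \<open>x\<close> with \<open>2 \<le> x \<le> P\<^sup>2 - P\<close> such that
  neither \<open>x\<close> nor \<open>x + d\<close> has a prime factor \<open>\<le> P\<close>; a number \<open>> 1\<close> below the square of the next
  prime with this property is prime.  For Goldbach take \<open>d = -2N\<close> and the largest \<open>P\<close> with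
  \<open>P\<^sup>2 < 2N\<close>; for prime pairs with difference \<open>2k\<close> take \<open>d = 2k\<close> and arbitrarily large \<open>P > 2k\<close>.
\<close>

section \<open>Indexing of the primes and divisors of primorials\<close>

lemma prime_eq_nth_prime:
  assumes "prime p"
  obtains i where "i \<ge> 1" "nth_prime i = p"
proof -
  obtain k where "enumerate {p::nat. prime p} k = p"
    using enumerate_Ex[OF primes_infinite, of p] assms by auto
  then show ?thesis
    using that[of "Suc k"] by (simp add: nth_prime_def)
qed

lemma prime_nth_prime: "prime (nth_prime i)"
  using enumerate_in_set[OF primes_infinite] by (simp add: nth_prime_def)

text \<open>\<open>enumerate\<close> is strictly increasing; the bounds exclude the index 0, where
  truncated subtraction makes \<open>nth_prime 0\<close> equal to
  \<open>nth_prime 1\<close>.\<close>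

lemma nth_prime_le_iff:
  assumes "i \<ge> 1" "j \<ge> 1"
  shows "nth_prime i \<le> nth_prime j \<longleftrightarrow> i \<le> j"
proof -
  have "strict_mono (enumerate {p::nat. prime p})"
    by (rule strict_mono_enumerate[OF primes_infinite])
  then show ?thesis
    using assms by (simp add: nth_prime_def strict_mono_less_eq le_diff_iff)
qed

text \<open>The primes 2 and 3 precede \<open>p\<close>, so its index is at least 3, the range in
  which the bound on \<open>h2\<close> is assumed.\<close>

lemma prime_ge_5_eq_nth_prime:
  assumes "prime p" "p \<ge> 5"
  obtains n where "n \<ge> 3" "nth_prime n = p"
proof -
  obtain i where i: "i \<ge> 1" "nth_prime i = 2"
    using prime_eq_nth_prime[of 2] by auto
  obtain j where j: "j \<ge> 1" "nth_prime j = 3"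
    using prime_eq_nth_prime[of 3] by auto
  obtain n where n: "n \<ge> 1" "nth_prime n = p"
    using prime_eq_nth_prime[OF assms(1)] by blast
  have "\<not> j \<le> i" "\<not> n \<le> j"
    using nth_prime_le_iff[OF j(1) i(1)] nth_prime_le_iff[OF n(1) j(1)] i j n assms(2) by auto
  with i(1) have "n \<ge> 3" by linarith
  with n show ?thesis using that by blast
qed

lemma primorial_pos: "primorial n > 0"
  unfolding primorial_def by (intro prod_pos) (simp add: prime_gt_0_nat prime_nth_prime)

lemma prime_dvd_primorial:
  assumes "prime p" "n \<ge> 1" "p \<le> nth_prime n"
  shows "p dvd primorial n"
proof -
  obtain i where i: "i \<ge> 1" "nth_prime i = p"
    using prime_eq_nth_prime[OF assms(1)] by blast
  then have "i \<in> {1..n}"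
    using assms nth_prime_le_iff[of i n] by auto
  then show ?thesis
    unfolding primorial_def using i by (metis dvd_prodI finite_atLeastAtMost)
qed

section \<open>Existence of the paired Jacobsthal value\<close>

text \<open>Evenness of \<open>b - a\<close> leaves one class free for \<open>p = 2\<close>; an odd
  prime has at least three classes, of which at most two are forbidden.\<close>

lemma residue_avoiding_pair:
  fixes a b :: int
  assumes "prime p" "2 dvd (b - a)"
  shows "\<exists>u::nat. \<not> int p dvd a + int u \<and> \<not> int p dvd b + int u"
proof (cases "p = 2")
  case True
  show ?thesis
  proof (cases "even a")
    case True
    then show ?thesis using assms(2) \<open>p = 2\<close> by (intro exI[of _ 1]) auto
  next
    case False
    then show ?thesis using assms(2) \<open>p = 2\<close> by (intro exI[of _ 0]) auto
  qed
next
  case False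
  with assms(1) have p: "p > 2"
    using prime_ge_2_nat[of p] by simp
  have no_dvd: "\<not> int p dvd 1" "\<not> int p dvd 2"
    using p by (auto dest: zdvd_imp_le)
  \<comment> \<open>Each of the two terms vanishes for at most one of \<open>u = 0, 1, 2\<close>.\<close>
  show ?thesis
  proof (rule ccontr)
    assume "\<not> ?thesis"
    then have *: "int p dvd a + int u \<or> int p dvd b + int u" for u by blast
    have "\<not> (int p dvd c + 0 \<and> int p dvd c + 1)" "\<not> (int p dvd c + 1 \<and> int p dvd c + 2)"
         "\<not> (int p dvd c + 0 \<and> int p dvd c + 2)" for c
      using no_dvd dvd_diff[of "int p" "c + 1" "c"] dvd_diff[of "int p" "c + 2" "c + 1"]
        dvd_diff[of "int p" "c + 2" "c"] by auto
    moreover have "int p dvd a + 0 \<or> int p dvd b + 0" "int p dvd a + 1 \<or> int p dvd b + 1"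
        "int p dvd a + 2 \<or> int p dvd b + 2"
      using *[of 0] *[of 1] *[of 2] by simp_all
    ultimately show False by metis
  qed
qed

text \<open>The Chinese remainder theorem glues the shifts that work for the single prime factors of
  \<open>n\<close>; hence a window of length \<open>n\<close> always suffices.\<close>

lemma coprime_pair_exists:
  fixes a b :: int
  assumes "n > 0" "2 dvd (b - a)"
  shows "\<exists>q\<in>{1..n}. coprime_pair (int n) (a + int q, b + int q)"
proof -
  obtain u where u: "\<And>p. prime p \<Longrightarrow> \<not> int p dvd a + int (u p) \<and> \<not> int p dvd b + int (u p)"
    using residue_avoiding_pair[OF _ assms(2)] by metis
  have "\<forall>p\<in>prime_factors n. \<forall>r\<in>prime_factors n. p \<noteq> r \<longrightarrow> coprime p r"
    by (auto intro: primes_coprime)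
  then obtain x where x: "\<forall>p\<in>prime_factors n. [x = u p] (mod p)"
    using chinese_remainder_nat[of "prime_factors n" "\<lambda>p. p" u] by auto
  \<comment> \<open>The window starts at 1, so the residue 0 is represented by
    \<open>n\<close>.\<close>
  define q where "q = (if x mod n = 0 then n else x mod n)"
  have q: "q \<in> {1..n}"
    using assms(1) by (auto simp: q_def Suc_le_eq less_imp_le)
  have "[q = x] (mod n)"
    by (auto simp: q_def cong_def)
  have no_dvd: "\<not> int p dvd a + int q \<and> \<not> int p dvd b + int q" if "prime p" "p dvd n" for p
  proof -
    have "p \<in> prime_factors n"
      using that assms(1) by (simp add: in_prime_factors_iff)
    with x have "[x = u p] (mod p)" by blast
    with cong_dvd_modulus_nat[OF \<open>[q = x] (mod n)\<close> that(2)]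
    have "[q = u p] (mod p)" by (rule cong_trans)
    then have "[int q = int (u p)] (mod int p)"
      by (simp add: cong_int_iff)
    then have "[c + int q = c + int (u p)] (mod int p)" for c
      by (simp add: cong_add_lcancel)
    then show ?thesis
      using u[OF that(1)] by (metis cong_dvd_iff)
  qed
  have "gcd (int n) c = 1" if c: "\<And>p. prime p \<Longrightarrow> p dvd n \<Longrightarrow> \<not> int p dvd c" for c
  proof (rule ccontr)
    assume "gcd (int n) c \<noteq> 1"
    then have "nat (gcd (int n) c) \<noteq> 1"
      by (simp add: nat_eq_iff)
    then obtain p where p: "prime p" "p dvd nat (gcd (int n) c)"
      using prime_factor_nat by blast
    then have "int p dvd gcd (int n) c"
      using int_dvd_int_iff[of p "nat (gcd (int n) c)"] by simp
    then have "p dvd n" "int p dvd c" by simp_all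
    with c p(1) show False by blast
  qed
  then have "coprime_pair (int n) (a + int q, b + int q)"
    using no_dvd by (simp only: coprime_pair_def fst_conv snd_conv) blast
  with q show ?thesis by (rule bexI[rotated])
qed

text \<open>A \<open>LEAST\<close> value is known to satisfy its predicate only once some witness
  exists; \<open>n\<close> itself is one.\<close>

lemma j2_coprime_pair:
  fixes a b :: int
  assumes "n > 0" "2 dvd (b - a)"
  obtains q where "q \<in> {1..j2 n}" "coprime_pair (int n) (a + int q, b + int q)"
proof -
  let ?Q = "\<lambda>m. m \<ge> 1 \<and> (\<forall>a b :: int. 2 dvd (b - a) \<longrightarrow>
        (\<exists>q\<in>{1..m}. coprime_pair (int n) (a + int q, b + int q)))"
  have "?Q n"
    using coprime_pair_exists assms(1) by auto
  then have "?Q (j2 n)"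
    unfolding j2_def by (rule LeastI)
  then have "\<exists>q\<in>{1..j2 n}. coprime_pair (int n) (a + int q, b + int q)"
    using assms(2) by simp
  then obtain q where "q \<in> {1..j2 n}" "coprime_pair (int n) (a + int q, b + int q)" ..
  then show ?thesis by (rule that)
qed

lemma coprime_not_dvd:
  fixes c :: int
  assumes "gcd (int n) c = 1" "prime p" "p dvd n"
  shows "\<not> int p dvd c"
proof
  assume "int p dvd c"
  with assms(3) have "int p dvd gcd (int n) c" by simp
  with assms(1,2) show False by (simp add: prime_nat_iff)
qed

section \<open>The sieve and the primality criterion\<close>

text \<open>Each prime up to \<open>P = nth_prime n\<close> divides \<open>primorial n\<close>, so
  coprimality to the primorial excludes all of them as divisors.\<close>

lemma paired_sieve:
  fixes d :: int
  assumes h2: "\<forall>n::nat. n \<ge> 3 \<longrightarrow> int (h2 n) < (int (nth_prime n))\<^sup>2 - int (nth_prime n)"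
    and P: "prime P" "P \<ge> 5" and d: "even d"
  obtains x :: nat where "x \<ge> 2" "int x \<le> (int P)\<^sup>2 - int P"
    "\<And>p. prime p \<Longrightarrow> p \<le> P \<Longrightarrow> \<not> p dvd x"
    "\<And>p. prime p \<Longrightarrow> p \<le> P \<Longrightarrow> \<not> int p dvd int x + d"
proof -
  obtain n where n: "n \<ge> 3" "nth_prime n = P"
    using prime_ge_5_eq_nth_prime[OF P] by blast
  \<comment> \<open>Starting the pair at 1 makes \<open>x = q + 1\<close> at least 2, which rules
    out the value 1; strictness of the bound on \<open>h2 n\<close> absorbs this extra one.\<close>
  obtain q where q: "q \<in> {1..h2 n}" "coprime_pair (int (primorial n)) (1 + int q, 1 + d + int q)"
    using j2_coprime_pair[OF primorial_pos, of "1 + d" 1 n] d by (auto simp: h2_def)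
  have dvd: "p dvd primorial n" if "prime p" "p \<le> P" for p
    using prime_dvd_primorial[of p n] that n by simp
  show ?thesis
  proof (rule that[of "Suc q"])
    show "int (Suc q) \<le> (int P)\<^sup>2 - int P"
      using h2 n q(1) by fastforce
    show "\<not> p dvd Suc q" if "prime p" "p \<le> P" for p
      using coprime_not_dvd[OF _ that(1) dvd[OF that], of "int (Suc q)"] q(2)
      unfolding int_dvd_int_iff by (simp add: coprime_pair_def)
    show "\<not> int p dvd int (Suc q) + d" if "prime p" "p \<le> P" for p
      using coprime_not_dvd[OF _ that(1) dvd[OF that], of "int (Suc q) + d"] q(2)
      by (simp add: coprime_pair_def algebra_simps)
  qed (use q(1) in simp)
qed

text \<open>In a nontrivial factorisation, any prime divisor of the smaller factor has a square of
  at most \<open>x\<close>.\<close>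

lemma prime_if_no_small_factor:
  fixes x :: nat
  assumes "x \<ge> 2" "\<And>p. prime p \<Longrightarrow> p\<^sup>2 \<le> x \<Longrightarrow> \<not> p dvd x"
  shows "prime x"
proof (rule ccontr)
  assume "\<not> prime x"
  then obtain m where "m dvd x" "m \<noteq> 1" "m \<noteq> x"
    using assms(1) by (auto simp: prime_nat_iff)
  then obtain k where mk: "x = m * k" "m \<noteq> 1" "k \<noteq> 1"
    by (auto elim!: dvdE)
  have *: False if "x = m * k" "m \<noteq> 1" "m \<le> k" for m k
  proof -
    obtain p where p: "prime p" "p dvd m"
      using prime_factor_nat \<open>m \<noteq> 1\<close> by blast
    have "m > 0" using that assms(1) by (cases m) auto
    then have "p \<le> m" using p dvd_imp_le by blast
    then have "p\<^sup>2 \<le> x"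
      using that by (auto simp: power2_eq_square intro!: mult_le_mono)
    then show False using assms(2)[OF p(1)] p(2) that(1) by simp
  qed
  show False
    using *[of m k] *[of k m] mk by (cases "m \<le> k") (auto simp: mult.commute)
qed

section \<open>Even numbers as sums of two primes\<close>

text \<open>These cases fall outside the sieve argument, which needs a prime of at least 5 with
  square below \<open>2 * n\<close>; explicit sums settle them.\<close>

lemma goldbach_small:
  assumes "1 < n" "n \<le> 12"
  shows "\<exists>q1 q2 :: nat. prime q1 \<and> prime q2 \<and> q1 + q2 = 2 * n"
proof -
  have primes: "prime (2::nat)" "prime (3::nat)" "prime (5::nat)" "prime (7::nat)"
    "prime (11::nat)" "prime (13::nat)" by simp_all
  have sums: "2 + 2 = 2 * (2::nat)" "3 + 3 = 2 * (3::nat)" "3 + 5 = 2 * (4::nat)"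
    "5 + 5 = 2 * (5::nat)" "5 + 7 = 2 * (6::nat)" "7 + 7 = 2 * (7::nat)"
    "5 + 11 = 2 * (8::nat)" "7 + 11 = 2 * (9::nat)" "7 + 13 = 2 * (10::nat)"
    "11 + 11 = 2 * (11::nat)" "11 + 13 = 2 * (12::nat)" by simp_all
  have "n = 2 \<or> n = 3 \<or> n = 4 \<or> n = 5 \<or> n = 6 \<or> n = 7 \<or> n = 8 \<or> n = 9 \<or> n = 10
      \<or> n = 11 \<or> n = 12"
    using assms by (auto simp: numeral_eq_Suc le_Suc_eq)
  then show ?thesis
    by (elim disjE) (hypsubst, use primes sums in blast)+
qed

text \<open>Both \<open>x\<close> and \<open>2 * n - x\<close> are below \<open>2 * n\<close>, so a
  prime whose square is at most one of them lies in \<open>S\<close>, hence is at most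
  \<open>P\<close> and already excluded by the sieve.\<close>

lemma goldbach_large:
  assumes h2: "\<forall>n::nat. n \<ge> 3 \<longrightarrow> int (h2 n) < (int (nth_prime n))\<^sup>2 - int (nth_prime n)"
    and n: "n > 12"
  shows "\<exists>q1 q2 :: nat. prime q1 \<and> prime q2 \<and> q1 + q2 = 2 * n"
proof -
  define S where "S = {p::nat. prime p \<and> p\<^sup>2 < 2 * n}"
  have "p \<le> 2 * n" if "p \<in> S" for p
  proof -
    have "p * 1 \<le> p * p" by (cases p) auto
    also have "\<dots> < 2 * n" using that by (simp add: S_def power2_eq_square)
    finally show ?thesis by simp
  qed
  then have "S \<subseteq> {..2 * n}" by auto
  then have fin: "finite S" by (rule finite_subset) simp
  \<comment> \<open>Here \<open>n > 12\<close> enters, as \<open>25 < 2 * n\<close>; it secures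
    \<open>P \<ge> 5\<close>, which the sieve requires.\<close>
  have "5 \<in> S" using n by (simp add: S_def)
  define P where "P = Max S"
  have "P \<in> S"
    unfolding P_def using fin \<open>5 \<in> S\<close> by (intro Max_in) auto
  have "5 \<le> P" and Pmax: "\<And>p. p \<in> S \<Longrightarrow> p \<le> P"
    using fin \<open>5 \<in> S\<close> by (auto simp: P_def)
  then have P: "prime P" "P\<^sup>2 < 2 * n" using \<open>P \<in> S\<close> by (auto simp: S_def)
  obtain x where x: "x \<ge> 2" "int x \<le> (int P)\<^sup>2 - int P"
    "\<And>p. prime p \<Longrightarrow> p \<le> P \<Longrightarrow> \<not> p dvd x"
    "\<And>p. prime p \<Longrightarrow> p \<le> P \<Longrightarrow> \<not> int p dvd int x + (- 2 * int n)"
    using paired_sieve[OF h2 P(1) \<open>5 \<le> P\<close>, of "- 2 * int n"] by auto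
  have "(int P)\<^sup>2 < 2 * int n"
    using P(2) by (metis of_nat_less_iff of_nat_mult of_nat_numeral of_nat_power)
  \<comment> \<open>The term \<open>- P\<close> in the bound keeps the second summand above 5, so it
    is neither 0 nor 1 and the natural subtraction is exact.\<close>
  with x(2) \<open>5 \<le> P\<close> have lt: "x + 5 < 2 * n" by linarith
  have "prime x"
  proof (rule prime_if_no_small_factor[OF x(1)])
    fix p assume "prime p" "p\<^sup>2 \<le> x"
    then have "p \<in> S" using lt by (simp add: S_def)
    then show "\<not> p dvd x" using x(3) Pmax \<open>prime p\<close> by blast
  qed
  moreover have "prime (2 * n - x)"
  proof (rule prime_if_no_small_factor)
    fix p assume p: "prime p" "p\<^sup>2 \<le> 2 * n - x"
    then have "p \<in> S" using lt x(1) by (simp add: S_def)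
    \<comment> \<open>The sieve speaks of \<open>x - 2 * n\<close>, the negative of the second
      summand; divisibility ignores the sign.\<close>
    then have "\<not> int p dvd - (int x + (- 2 * int n))"
      unfolding dvd_minus_iff using x(4) Pmax \<open>prime p\<close> by blast
    moreover have "- (int x + (- 2 * int n)) = int (2 * n - x)"
      using lt by (simp add: of_nat_diff)
    ultimately show "\<not> p dvd 2 * n - x"
      by (simp only: int_dvd_int_iff) simp
  qed (use lt in simp)
  ultimately show ?thesis
    using lt by (intro exI[of _ x] exI[of _ "2 * n - x"]) simp
qed

section \<open>Prime pairs with a fixed even difference\<close>

lemma prime_pair_above:
  assumes h2: "\<forall>n::nat. n \<ge> 3 \<longrightarrow> int (h2 n) < (int (nth_prime n))\<^sup>2 - int (nth_prime n)"
  shows "\<exists>q::nat. q > B \<and> prime q \<and> prime (q + 2 * n)"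
proof -
  \<comment> \<open>\<open>P > 2 * n\<close> keeps \<open>x + 2 * n\<close> below the square of
    \<open>P\<close>, while \<open>P > B\<close> pushes the pair past \<open>B\<close>.\<close>
  obtain P where P: "prime P" "P > max (max B (2 * n)) 5"
    using bigger_prime by blast
  then have P5: "5 \<le> P" by simp
  obtain x where x: "x \<ge> 2" "int x \<le> (int P)\<^sup>2 - int P"
    "\<And>p. prime p \<Longrightarrow> p \<le> P \<Longrightarrow> \<not> p dvd x"
    "\<And>p. prime p \<Longrightarrow> p \<le> P \<Longrightarrow> \<not> int p dvd int x + 2 * int n"
    using paired_sieve[OF h2 P(1) P5, of "2 * int n"] by auto
  have "int (x + 2 * n) < (int P)\<^sup>2"
    using x(2) P(2) by simp
  then have lt: "x + 2 * n < P\<^sup>2"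
    by (metis of_nat_less_iff of_nat_power)
  have small: "p \<le> P" if "p\<^sup>2 \<le> x + 2 * n" for p
    using that lt by (meson le_less_trans less_imp_le power_less_imp_less_base zero_le)
  have "prime x"
    using prime_if_no_small_factor[OF x(1)] x(3) small by (meson le_add1 le_trans)
  moreover have "prime (x + 2 * n)"
  proof (rule prime_if_no_small_factor)
    fix p assume p: "prime p" "p\<^sup>2 \<le> x + 2 * n"
    then have "\<not> int p dvd int (x + 2 * n)" using x(4) small by simp
    then show "\<not> p dvd x + 2 * n" by (simp only: int_dvd_int_iff) simp
  qed (use x in simp)
  \<comment> \<open>A prime \<open>x \<le> P\<close> would be excluded by the sieve as its own
    divisor, so \<open>x > P > B\<close>.\<close>
  moreover have "x > B"
    using x(3)[OF \<open>prime x\<close>] P(2) by force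
  ultimately show ?thesis by blast
qed

theorem theorem4p1:
  assumes "\<forall>n::nat. n \<ge> 3 \<longrightarrow> int (h2 n) < (int (nth_prime n))\<^sup>2 - int (nth_prime n)"
  shows "(\<forall>n::nat. n > 1 \<longrightarrow>
            (\<exists>q1 q2 :: nat. prime q1 \<and> prime q2 \<and> q1 + q2 = 2 * n)) \<and>
         (\<forall>n::nat. n \<ge> 1 \<longrightarrow>
            infinite {(q1 :: nat, q2 :: nat). prime q1 \<and> prime q2 \<and> int q2 - int q1 = 2 * int n})"
proof (intro conjI allI impI)
  fix n :: nat
  assume "n > 1"
  then show "\<exists>q1 q2 :: nat. prime q1 \<and> prime q2 \<and> q1 + q2 = 2 * n"
    using goldbach_small goldbach_large[OF assms] by (cases "n \<le> 12") auto
next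
  fix n :: nat
  let ?S = "{(q1 :: nat, q2 :: nat). prime q1 \<and> prime q2 \<and> int q2 - int q1 = 2 * int n}"
  \<comment> \<open>Unbounded first components suffice: a finite set of pairs would have a finite
    projection.\<close>
  have "\<exists>q. q > B \<and> q \<in> fst ` ?S" for B
  proof -
    obtain q where q: "q > B" "prime q" "prime (q + 2 * n)"
      using prime_pair_above[OF assms] by blast
    then have "(q, q + 2 * n) \<in> ?S" by simp
    then have "q \<in> fst ` ?S" by (metis (no_types, lifting) fst_conv image_eqI)
    with q(1) show ?thesis by blast
  qed
  then have "infinite (fst ` ?S)"
    unfolding infinite_nat_iff_unbounded by blast
  then show "infinite ?S"
    using finite_imageI by blast
qed

end
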